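(* For an arbitrary instance of problem (MOCP) with $q+1$ objectives, let $\mathcal{P}$ be its upper image and let $\mathcal{P}_{inner}$ be the result of the dual Benson type algorithm (described in the context) for some given tolerance $\varepsilon>0$. Then $$d_H(\mathcal{P}_{inner},\mathcal{P})\le \varepsilon\sqrt{q+1}.$$
   Context: Notation: $e$ is the all-ones vector of appropriate dimension, inequalities between vectors are componentwise, $\mathbb{R}^{q+1}_+=\{y\in\mathbb{R}^{q+1}: y\ge 0\}$. $d_H$ is the Hausdorff distance with respect to the Euclidean norm; for nonempty $M\subseteq N$ it equals $d_H(M,N)=\sup_{b\in N}\inf_{a\in M}\|a-b\|_2$. Problem (MOCP): let $G\in\mathbb{R}^{q\times n}$ have full row rank and let $g_1,\dots,g_m:\mathbb{R}^n\to\mathbb{R}\cup\{\infty\}$ be convex functions such that $X=\{x\in\mathbb{R}^n: g_1(x)\le 0,\dots,g_m(x)\le 0\}$ is a convex body (convex, compact, with nonempty interior). (MOCP) is to minimize $\Gamma(x)=\begin{pmatrix}Gx\\ -e^TGx\end{pmatrix}\in\mathbb{R}^{q+1}$ with respect to the componentwise order subject to $x\in X$. Its upper image is $\mathcal{P}=\Gamma[X]+\mathbb{R}^{q+1}_+$, where $\Gamma[X]=\{\Gamma(x):x\in X\}$. For $t\in\mathbb{R}^{q+1}$ put $w(t)=(t_1,\dots,t_q,1-\sum_{i=1}^q t_i)^T$. The coupling function is $\varphi(y,y^* )=\sum_{i=1}^q y_iy_i^*+y_{q+1}\bigl(1-\sum_{i=1}^q y_i^*\bigr)-y^*_{q+1}$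 for $y,y^*\in\mathbb{R}^{q+1}$. For $w\in\mathbb{R}^{q+1}$ with $e^Tw=1$, $(P_1(w))$ is the problem $\min_x w^T\Gamma(x)$ subject to $x\in X$. Dual Benson type algorithm with tolerance $\varepsilon>0$: (1) Choose some $\bar w>0$ (all components positive) with $e^T\bar w=1$, let $\bar x$ be an optimal solution of $(P_1(\bar w))$, $\mathcal{P}_0=\{\Gamma(\bar x)\}+\mathbb{R}^{q+1}_+$ and $\mathcal{D}_0=\{y^*\in\mathbb{R}^{q+1}: \varphi(y,y^* )\ge 0\ \text{for all } y\in\mathcal{P}_0\}$. Set $T:=\emptyset$, $\mathcal{D}_{outer}:=\mathcal{D}_0$, and let $\bar T$ be the vertex set of $\mathcal{D}_{outer}$. (2) While $\bar T\setminus T\neq\emptyset$: choose any $t\in\bar T\setminus T$; compute an optimal solution $x$ of $(P_1(w(t)))$; if $\varphi(\Gamma(x),t)<-\varepsilon$, replace $\mathcal{D}_{outer}$ by $\mathcal{D}_{outer}\cap\{y^*\in\mathbb{R}^{q+1}:\varphi(\Gamma(x),y^* )\ge 0\}$ and let $\bar T$ be the vertex set of the new $\mathcal{D}_{outer}$; otherwise replace $T$ by $T\cup\{t\}$. (3) When the loop ends, return $\mathcal{P}_{inner}=\{y\in\mathbb{R}^{q+1}: \varphi(y,y^* )\ge 0\ \text{for all } y^*\in\mathcal{D}_{outer}\}$. The "result" of the algorithm is the set $\mathcal{P}_{inner}$ returned upon termination. *)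

theory Defs
  imports "HOL-Analysis.Analysis"
begin

text \<open>
  The space of \<open>q + 1\<close> coordinates is modelled as \<open>(real^'q) \<times> real\<close>: the first component collects
  the coordinates \<open>1, \<dots>, q\<close>, the second one is the coordinate \<open>q + 1\<close>.  The library's norm and
  distance on this product are the Euclidean ones, and its order is the componentwise order.
\<close>

text \<open>
  Convexity of functions with values in \<open>\<real> \<union> {\<infinity>}\<close>.  The library's \<open>convex_on\<close> only covers
  real-valued functions.
\<close>

definition ext_convex :: "('a::real_vector \<Rightarrow> ereal) \<Rightarrow> bool" where
  "ext_convex f \<longleftrightarrow>
     (\<forall>x. f x \<noteq> -\<infinity>) \<and>
     (\<forall>x y. \<forall>u::real. 0 < u \<and> u < 1 \<longrightarrow>
        f (u *\<^sub>R x + (1 - u) *\<^sub>R y) \<le> ereal u * f x + ereal (1 - u) * f y)"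

definition convex_body :: "'a::euclidean_space set \<Rightarrow> bool" where
  "convex_body S \<longleftrightarrow> convex S \<and> compact S \<and> interior S \<noteq> {}"

text \<open>
  Extended-valued, since both sets of interest are unbounded.  An infimum over the empty set
  is \<open>\<infinity>\<close>, so that a finite bound cannot hold vacuously because one of the two sets is empty.
\<close>

definition hausdorff_dist :: "'a::metric_space set \<Rightarrow> 'a set \<Rightarrow> ennreal" where
  "hausdorff_dist A B =
     max (SUP a\<in>A. INF b\<in>B. ennreal (dist a b)) (SUP b\<in>B. INF a\<in>A. ennreal (dist a b))"

lemma hausdorff_dist_subset:
  assumes "A \<subseteq> B"
  shows "hausdorff_dist A B = (SUP b\<in>B. INF a\<in>A. ennreal (dist a b))"
proof -
  have "(INF b\<in>B. ennreal (dist a b)) \<le> 0" if "a \<in> A" for a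
    using INF_lower[of a B "\<lambda>b. ennreal (dist a b)"] that assms by auto
  then have "(SUP a\<in>A. INF b\<in>B. ennreal (dist a b)) \<le> 0"
    by (rule SUP_least)
  then show ?thesis
    by (simp add: hausdorff_dist_def max_def)
qed

definition feasible_set :: "('m::finite \<Rightarrow> real^'n \<Rightarrow> ereal) \<Rightarrow> (real^'n) set" where
  "feasible_set g = {x. \<forall>i. g i x \<le> 0}"

definition objective :: "real^'n^'q \<Rightarrow> real^'n \<Rightarrow> (real^'q) \<times> real" where
  "objective G x = (G *v x, - (\<Sum>i\<in>UNIV. (G *v x) $ i))"

definition upper_image :: "real^'n^'q \<Rightarrow> (real^'n) set \<Rightarrow> ((real^'q) \<times> real) set" where
  "upper_image G X = objective G ` X + {0..}"

definition weight :: "(real^'q) \<times> real \<Rightarrow> (real^'q) \<times> real" where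
  "weight t = (fst t, 1 - (\<Sum>i\<in>UNIV. fst t $ i))"

definition coupling :: "(real^'q) \<times> real \<Rightarrow> (real^'q) \<times> real \<Rightarrow> real" where
  "coupling y y' =
     (\<Sum>i\<in>UNIV. fst y $ i * fst y' $ i) + snd y * (1 - (\<Sum>i\<in>UNIV. fst y' $ i)) - snd y'"

definition scalarization_solution ::
    "real^'n^'q \<Rightarrow> (real^'n) set \<Rightarrow> (real^'q) \<times> real \<Rightarrow> real^'n \<Rightarrow> bool" where
  "scalarization_solution G X w x \<longleftrightarrow> is_arg_min (\<lambda>x. w \<bullet> objective G x) (\<lambda>x. x \<in> X) x"

definition vertices :: "'a::real_vector set \<Rightarrow> 'a set" where
  "vertices D = {t. t extreme_point_of D}"

text \<open>
  \<open>dual_benson_state G X \<epsilon> D T T'\<close> holds if some run of the algorithm reaches the beginning of the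
  loop with \<open>D\<close> as outer approximation, \<open>T\<close> as set of accepted vertices and \<open>T'\<close> as current
  vertex set.  All choices (of \<open>w\<close>, of the optimal solutions, and of the vertex to be
  processed) are nondeterministic.
\<close>

inductive dual_benson_state ::
    "real^'n^'q \<Rightarrow> (real^'n) set \<Rightarrow> real \<Rightarrow>
     ((real^'q) \<times> real) set \<Rightarrow> ((real^'q) \<times> real) set \<Rightarrow> ((real^'q) \<times> real) set \<Rightarrow> bool"
  for G :: "real^'n^'q" and X :: "(real^'n) set" and \<epsilon> :: real
where
  init:
    "dual_benson_state G X \<epsilon> D {} (vertices D)"
    if "\<forall>i. 0 < fst w $ i" and "0 < snd w" and "(\<Sum>i\<in>UNIV. fst w $ i) + snd w = 1"
      and "scalarization_solution G X w x"
      and "D = {y'. \<forall>y \<in> {objective G x} + {0..}. 0 \<le> coupling y y'}"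
| cut:
    "dual_benson_state G X \<epsilon> D' T (vertices D')"
    if "dual_benson_state G X \<epsilon> D T T'" and "t \<in> T' - T"
      and "scalarization_solution G X (weight t) x"
      and "coupling (objective G x) t < - \<epsilon>"
      and "D' = D \<inter> {y'. 0 \<le> coupling (objective G x) y'}"
| accept:
    "dual_benson_state G X \<epsilon> D (T \<union> {t}) T'"
    if "dual_benson_state G X \<epsilon> D T T'" and "t \<in> T' - T"
      and "scalarization_solution G X (weight t) x"
      and "\<not> coupling (objective G x) t < - \<epsilon>"

definition dual_benson_result ::
    "real^'n^'q \<Rightarrow> (real^'n) set \<Rightarrow> real \<Rightarrow> ((real^'q) \<times> real) set \<Rightarrow> bool" where
  "dual_benson_result G X \<epsilon> P \<longleftrightarrow>
     (\<exists>D T T'. dual_benson_state G X \<epsilon> D T T' \<and> T' - T = {} \<and>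
        P = {y. \<forall>y'\<in>D. 0 \<le> coupling y y'})"

end

theory Submission
  imports Defs
begin

text \<open>
  The coupling function is \<open>coupling y t = weight t \<bullet> y - snd t\<close>; for a fixed \<open>y\<close> it is affine in \<open>t\<close>,
  and it grows by \<open>\<epsilon>\<close> when \<open>\<epsilon>\<close> is added to every coordinate of \<open>y\<close>, because the coordinates of
  \<open>weight t\<close> sum to one.  Each point \<open>t\<close> with \<open>weight t \<ge> 0\<close> is thus a halfspace of points \<open>y\<close> with
  \<open>weight t \<bullet> y \<ge> snd t\<close>, and cutting the outer approximation \<open>D\<close> means discarding those \<open>t\<close> whose
  halfspace misses an objective value.

  No cut discards a valid halfspace, that is, one that contains the upper image \<open>P\<close>.  As \<open>P\<close>
  is closed, convex and upward closed, it is the intersection of its valid halfspaces; hence the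
  result \<open>P_inner\<close>, an intersection over the possibly larger \<open>D\<close>, is contained in \<open>P\<close>.

  On termination every vertex \<open>t\<close> of \<open>D\<close> has been accepted: some minimiser of \<open>weight t \<bullet> objective G x\<close>
  violates \<open>0 \<le> coupling (objective G x) t\<close> by at most \<open>\<epsilon>\<close>, and then so does every point
  of \<open>P\<close>.  For \<open>y \<in> P\<close> the affine function \<open>coupling y\<close> attains its minimum over \<open>D\<close> at a
  vertex, although \<open>D\<close> is unbounded: weights lie in a simplex, so
  \<open>D\<close> is unbounded only in the direction of decreasing last coordinate, along which \<open>coupling y\<close>
  increases.  So \<open>coupling y \<ge> -\<epsilon>\<close> on all of \<open>D\<close>, and raising each of the \<open>q + 1\<close> coordinates
  of \<open>y\<close> by \<open>\<epsilon>\<close> yields a point of \<open>P_inner\<close> at distance \<open>\<epsilon> * sqrt (q + 1)\<close> from \<open>y\<close>.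
\<close>

section \<open>Minimising a linear functional over an unbounded convex set\<close>

text \<open>
  The minimum of \<open>a \<bullet> s\<close> over \<open>D\<close> exists because one sublevel set is compact. The minimisers form a
  compact face of \<open>D\<close>, which has an extreme point by Krein--Milman, and extreme points of a face are
  extreme in \<open>D\<close>.
\<close>

lemma extreme_point_below:
  fixes D :: "'a::euclidean_space set"
  assumes "closed D" "convex D" "t \<in> D" "bounded {s \<in> D. a \<bullet> s \<le> a \<bullet> t}"
  obtains v where "v extreme_point_of D" "a \<bullet> v \<le> a \<bullet> t"
proof -
  let ?S = "{s \<in> D. a \<bullet> s \<le> a \<bullet> t}"
  have "?S = D \<inter> {s. a \<bullet> s \<le> a \<bullet> t}" by auto
  then have S: "compact ?S"
    using assms by (simp add: compact_eq_bounded_closed closed_Int closed_halfspace_le)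
  have "?S \<noteq> {}" using assms by auto
  moreover have "continuous_on ?S (\<lambda>s. a \<bullet> s)" by (intro continuous_intros)
  ultimately have "\<exists>m\<in>?S. \<forall>s\<in>?S. a \<bullet> m \<le> a \<bullet> s"
    by (rule continuous_attains_inf[OF S])
  then obtain m where m: "m \<in> ?S" "\<forall>s\<in>?S. a \<bullet> m \<le> a \<bullet> s" ..
  have min: "a \<bullet> m \<le> a \<bullet> s" if "s \<in> D" for s
    using m that by (cases "a \<bullet> s \<le> a \<bullet> t") auto
  let ?F = "D \<inter> {s. a \<bullet> s = a \<bullet> m}"
  have face: "?F face_of D"
    using min by (intro face_of_Int_supporting_hyperplane_ge assms) auto
  have "?F = ?S \<inter> {s. a \<bullet> s = a \<bullet> m}" using m by auto
  then have "compact ?F" using S by (simp add: compact_Int_closed closed_hyperplane)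
  moreover have "convex ?F" using face by (rule face_of_imp_convex)
  moreover have "?F \<noteq> {}" using m by auto
  ultimately obtain v where "v extreme_point_of ?F"
    using extreme_point_exists_convex by blast
  then have "v extreme_point_of D" "v \<in> ?F"
    using extreme_point_of_face[OF face] by auto
  then show thesis using that m by auto
qed

section \<open>The coupling function and weights\<close>

lemma coupling_eq_weight: "coupling y t = weight t \<bullet> y - snd t"
  by (simp add: coupling_def weight_def inner_prod_def inner_vec_def mult.commute)

text \<open>
  Being affine in \<open>t\<close>, the coupling cuts out halfspaces of dual points and is minimised over a convex
  set of dual points at an extreme point.
\<close>

lemma coupling_affine: "coupling y t = ((\<chi> i. fst y $ i - snd y), -1) \<bullet> t + snd y"
  by (simp add: coupling_def inner_prod_def inner_vec_def left_diff_distrib right_diff_distrib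
      sum_subtractf flip: sum_distrib_left)

lemma inner_one_weight: "(1, 1) \<bullet> weight t = 1"
  by (simp add: weight_def inner_prod_def inner_vec_def)

lemma coupling_add_scaled_one: "coupling (y + c *\<^sub>R (1, 1)) t = coupling y t + c"
  using inner_one_weight[of t]
  by (simp add: coupling_eq_weight inner_add_right inner_commute del: scaleR_Pair)

lemma norm_one_Pair_one: "norm (1 :: real^'q, 1 :: real) = sqrt (real CARD('q) + 1)"
  by (simp add: norm_eq_sqrt_inner inner_prod_def inner_vec_def)

section \<open>Valid halfspaces separating points from an upward closed set\<close>

lemma nonneg_if_inner_nonneg:
  fixes a :: "'a::ordered_euclidean_space"
  assumes "\<And>b. 0 \<le> b \<Longrightarrow> 0 \<le> a \<bullet> b"
  shows "0 \<le> a"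
  unfolding eucl_le[of 0 a] using assms by simp

lemma nonneg_inner_one_pos:
  fixes a :: "(real^'q) \<times> real"
  assumes "0 \<le> a" "a \<noteq> 0"
  shows "0 < (1, 1) \<bullet> a"
proof -
  have nn: "0 \<le> fst a $ i" "0 \<le> snd a" for i
    using assms by (auto simp: less_eq_prod_def less_eq_vec_def)
  then have "(1, 1) \<bullet> a \<noteq> 0"
    using assms(2)
    by (auto simp: inner_prod_def inner_vec_def prod_eq_iff vec_eq_iff
        add_nonneg_eq_0_iff sum_nonneg sum_nonneg_eq_0_iff)
  moreover have "0 \<le> (1, 1) \<bullet> a"
    using nn by (auto simp: inner_prod_def inner_vec_def intro!: add_nonneg_nonneg sum_nonneg)
  ultimately show ?thesis by simp
qed

lemma weight_of_sum_one:
  assumes "(1, 1) \<bullet> w = 1"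
  shows "weight (fst w, b) = w"
  using assms by (auto simp: weight_def inner_prod_def inner_vec_def prod_eq_iff)

lemma nonneg_if_linear_bounded_below:
  fixes b c d :: real
  assumes "\<And>s. 0 \<le> s \<Longrightarrow> b \<le> c + s * d"
  shows "0 \<le> d"
proof (rule ccontr)
  assume "\<not> 0 \<le> d"
  then have "b \<le> c + ((\<bar>c - b\<bar> + 1) / (- d)) * d"
    using \<open>\<not> 0 \<le> d\<close> by (intro assms) (simp add: divide_le_0_iff)
  also have "\<dots> = c - (\<bar>c - b\<bar> + 1)"
    using \<open>\<not> 0 \<le> d\<close> by (simp add: field_simps)
  finally show False by linarith
qed

text \<open>
  A hyperplane that separates \<open>y\<close> from \<open>A + {0..}\<close> has a nonnegative normal, for otherwise its functional
  would be unbounded below on \<open>A + {0..}\<close>. The normal is nonzero, so its coordinates can be scaled to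
  sum to one, and it becomes the weight of a dual point whose last coordinate is the separating level.
\<close>

lemma supporting_weight:
  fixes A :: "((real^'q) \<times> real) set"
  assumes "compact A" "convex A" "A \<noteq> {}" "y \<notin> A + {0..}"
  obtains t where "0 \<le> weight t" "coupling y t < 0" "\<And>p. p \<in> A \<Longrightarrow> 0 \<le> coupling p t"
proof -
  let ?P = "A + {0..}"
  have "convex {0 :: (real^'q) \<times> real..}"
    by (auto simp: convex_def intro!: add_nonneg_nonneg scaleR_nonneg_nonneg)
  then have "convex ?P" using assms by (intro convex_set_plus)
  moreover have "closed ?P"
  proof -
    have "?P = (\<Union>x\<in>A. \<Union>y\<in>{0..}. {x + y})" by (auto simp: set_plus_def)
    then show ?thesis using compact_closed_sums[OF assms(1) closed_eucl_atLeast] by simp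
  qed
  ultimately obtain a b where ab: "a \<bullet> y < b" "\<And>p. p \<in> ?P \<Longrightarrow> b < a \<bullet> p"
    using separating_hyperplane_closed_point[of ?P y] assms(4) by blast
  have shift: "b < a \<bullet> p + a \<bullet> r" if "p \<in> A" "0 \<le> r" for p r
    using ab(2)[of "p + r"] that by (auto simp: inner_add_right intro: set_plus_intro)
  obtain p where p: "p \<in> A" using assms by auto
  have a0: "0 \<le> a"
  proof (rule nonneg_if_inner_nonneg)
    fix r :: "(real^'q) \<times> real" assume r: "0 \<le> r"
    show "0 \<le> a \<bullet> r"
    proof (rule nonneg_if_linear_bounded_below)
      fix s :: real assume "0 \<le> s"
      then show "b \<le> a \<bullet> p + s * (a \<bullet> r)"
        using shift[OF p, of "s *\<^sub>R r"] r by (auto simp: scaleR_nonneg_nonneg)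
    qed
  qed
  have "a \<noteq> 0" using ab(1) shift[OF p, of 0] by auto
  define k where "k = (1, 1) \<bullet> a"
  have k: "0 < k" unfolding k_def using a0 \<open>a \<noteq> 0\<close> by (rule nonneg_inner_one_pos)
  define w where "w = (1 / k) *\<^sub>R a"
  define t where "t = (fst w, b / k)"
  have "(1, 1) \<bullet> w = 1" using k by (simp add: w_def flip: k_def)
  then have wt: "weight t = w" unfolding t_def by (rule weight_of_sum_one)
  have c: "coupling z t = (a \<bullet> z - b) / k" for z
    by (simp add: coupling_eq_weight wt, simp add: w_def t_def diff_divide_distrib)
  show thesis
  proof (rule that)
    show "0 \<le> weight t" using k a0 by (simp add: wt w_def scaleR_nonneg_nonneg)
    show "coupling y t < 0" using k ab(1) by (simp add: c divide_less_0_iff)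
    show "0 \<le> coupling z t" if "z \<in> A" for z
      using k shift[OF that, of 0] by (simp add: c)
  qed
qed

section \<open>Boundedness of the dual sublevel sets\<close>

lemma coupling_mono:
  assumes "0 \<le> weight t" "y \<le> z"
  shows "coupling y t \<le> coupling z t"
  using inner_nonneg_nonneg[of "weight t" "z - y"] assms
  by (simp add: coupling_eq_weight inner_diff_right)

lemma weight_le_one:
  assumes "0 \<le> weight t"
  shows "weight t \<le> (1, 1)"
proof -
  have nn: "0 \<le> fst t $ i" "(\<Sum>i\<in>UNIV. fst t $ i) \<le> 1" for i
    using assms by (auto simp: weight_def less_eq_prod_def less_eq_vec_def)
  have "fst t $ i \<le> 1" for i
    using member_le_sum[of i UNIV "\<lambda>i. fst t $ i"] nn by fastforce
  then show ?thesis using nn by (auto simp: weight_def less_eq_prod_def less_eq_vec_def sum_nonneg)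
qed

text \<open>
  The weights range over a simplex, so the two inequalities on the coupling confine the last coordinate
  to an interval: the one at \<open>p\<close> bounds it from above, the one at \<open>y\<close> from below.
\<close>

lemma bounded_coupling_between:
  fixes p y :: "(real^'q) \<times> real"
  shows "bounded {t. 0 \<le> weight t \<and> 0 \<le> coupling p t \<and> coupling y t \<le> c}"
proof -
  have "bounded {0 :: (real^'q) \<times> real..(1, 1)}" by (rule bounded_closed_interval)
  then obtain B where B: "\<And>w. w \<in> {0 :: (real^'q) \<times> real..(1, 1)} \<Longrightarrow> norm w \<le> B"
    unfolding bounded_iff by blast
  let ?box = "{0..1 :: real^'q} \<times> {- (B * norm y) - c..B * norm p}"
  have "t \<in> ?box"
    if t: "0 \<le> weight t" "0 \<le> coupling p t" "coupling y t \<le> c" for t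
  proof -
    have "weight t \<le> (1, 1)" using t(1) by (rule weight_le_one)
    with t(1) have "weight t \<in> {0..(1, 1)}" by (simp only: atLeastAtMost_iff)
    then have "norm (weight t) \<le> B" by (rule B)
    then have *: "\<bar>weight t \<bullet> z\<bar> \<le> B * norm z" for z
      using Cauchy_Schwarz_ineq2[of "weight t" z] mult_right_mono[of _ B "norm z"]
      by (meson norm_ge_zero order_trans)
    have "snd t \<le> B * norm p" "- (B * norm y) - c \<le> snd t"
      using t(2,3) *[of p] *[of y] by (auto simp: coupling_eq_weight)
    moreover have "0 \<le> fst t" "fst t \<le> 1"
      using t(1) \<open>weight t \<le> (1, 1)\<close> by (auto simp: weight_def less_eq_prod_def)
    ultimately show ?thesis by (cases t) auto
  qed
  then have "{t. 0 \<le> weight t \<and> 0 \<le> coupling p t \<and> coupling y t \<le> c} \<subseteq> ?box" by blast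
  moreover have "bounded ?box" by (intro bounded_Times bounded_closed_interval)
  ultimately show ?thesis by (rule bounded_subset[rotated])
qed

section \<open>Invariants of the algorithm\<close>

lemma convex_coupling_nonneg: "convex {t. 0 \<le> coupling y t}"
proof -
  have "{t. 0 \<le> coupling y t} = {t. ((\<chi> i. fst y $ i - snd y), -1) \<bullet> t \<ge> - snd y}"
    by (auto simp: coupling_affine)
  then show ?thesis by (simp only: convex_halfspace_ge)
qed

lemma closed_coupling_nonneg: "closed {t. 0 \<le> coupling y t}"
proof -
  have "{t. 0 \<le> coupling y t} = {t. ((\<chi> i. fst y $ i - snd y), -1) \<bullet> t \<ge> - snd y}"
    by (auto simp: coupling_affine)
  then show ?thesis by (simp only: closed_halfspace_ge)
qed

text \<open>
  Requiring the inequality on the whole orthant above \<open>p\<close> is what forces weights to be nonnegative.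
\<close>

lemma initial_outer_eq:
  fixes p :: "(real^'q) \<times> real"
  shows "{t. \<forall>y \<in> {p} + {0..}. 0 \<le> coupling y t} = {t. 0 \<le> weight t \<and> 0 \<le> coupling p t}"
proof (intro set_eqI iffI)
  fix t :: "(real^'q) \<times> real"
  assume "t \<in> {t. \<forall>y \<in> {p} + {0..}. 0 \<le> coupling y t}"
  then have nn: "0 \<le> coupling (p + r) t" if "0 \<le> r" for r
    using that by (simp add: set_plus_intro)
  have "0 \<le> weight t"
  proof (rule nonneg_if_inner_nonneg)
    fix r :: "(real^'q) \<times> real" assume r: "0 \<le> r"
    show "0 \<le> weight t \<bullet> r"
    proof (rule nonneg_if_linear_bounded_below)
      fix s :: real assume "0 \<le> s"
      then show "0 \<le> coupling p t + s * (weight t \<bullet> r)"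
        using nn[OF scaleR_nonneg_nonneg[OF _ r], of s]
        by (simp add: coupling_eq_weight inner_add_right)
    qed
  qed
  then show "t \<in> {t. 0 \<le> weight t \<and> 0 \<le> coupling p t}" using nn[of 0] by simp
next
  fix t :: "(real^'q) \<times> real"
  assume t: "t \<in> {t. 0 \<le> weight t \<and> 0 \<le> coupling p t}"
  have "0 \<le> coupling y t" if y: "y \<in> {p} + {0..}" for y
  proof -
    obtain r where "0 \<le> r" "y = p + r" using y by (auto elim: set_plus_elim)
    then have "p \<le> y" by simp
    then have "coupling p t \<le> coupling y t" using t by (intro coupling_mono) simp_all
    then show ?thesis using t by simp
  qed
  then show "t \<in> {t. \<forall>y \<in> {p} + {0..}. 0 \<le> coupling y t}" by blast
qed

text \<open>
  A minimiser of the scalarised problem also minimises \<open>coupling (objective G x) t\<close> over \<open>x\<close>, because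
  these differ by the constant \<open>snd t\<close>; so the acceptance test at one minimiser yields the bound for all
  feasible points.
\<close>

lemma dual_benson_state_invariant:
  assumes "dual_benson_state G X \<epsilon> D T T'"
  shows "closed D" "convex D" "T' = vertices D"
    and "\<exists>p. D \<subseteq> {t. 0 \<le> weight t \<and> 0 \<le> coupling p t}"
    and "{t. 0 \<le> weight t \<and> (\<forall>x\<in>X. 0 \<le> coupling (objective G x) t)} \<subseteq> D"
    and "\<forall>t\<in>T. \<forall>x\<in>X. - \<epsilon> \<le> coupling (objective G x) t"
proof -
  have "closed D \<and> convex D \<and> T' = vertices D
    \<and> (\<exists>p. D \<subseteq> {t. 0 \<le> weight t \<and> 0 \<le> coupling p t})
    \<and> {t. 0 \<le> weight t \<and> (\<forall>x\<in>X. 0 \<le> coupling (objective G x) t)} \<subseteq> D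
    \<and> (\<forall>t\<in>T. \<forall>x\<in>X. - \<epsilon> \<le> coupling (objective G x) t)"
    using assms
  proof induction
    case (init w x D)
    have "D = (\<Inter>y\<in>{objective G x} + {0..}. {t. 0 \<le> coupling y t})"
      using init(5) by auto
    then have "closed D" "convex D"
      by (simp_all add: closed_INT convex_INT closed_coupling_nonneg convex_coupling_nonneg)
    moreover have "D = {t. 0 \<le> weight t \<and> 0 \<le> coupling (objective G x) t}"
      using init(5) initial_outer_eq by simp
    moreover have "x \<in> X"
      using init(4) by (simp add: scalarization_solution_def is_arg_min_def)
    ultimately show ?case by (auto simp del: split_paired_Ex)
  next
    case (cut D T T' t x D')
    have "x \<in> X" using cut(3) by (simp add: scalarization_solution_def is_arg_min_def)
    then show ?case
      using cut(5,6)
      by (auto intro!: closed_Int convex_Int closed_coupling_nonneg convex_coupling_nonneg)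
  next
    case (accept D T T' t x)
    have "coupling (objective G x) t \<le> coupling (objective G z) t" if "z \<in> X" for z
      using accept(3) that
      by (auto simp: scalarization_solution_def is_arg_min_def coupling_eq_weight not_less)
    then have "\<forall>z\<in>X. - \<epsilon> \<le> coupling (objective G z) t"
      using accept(4) by force
    then show ?case using accept(5) by auto
  qed
  then show "closed D" "convex D" "T' = vertices D"
    "\<exists>p. D \<subseteq> {t. 0 \<le> weight t \<and> 0 \<le> coupling p t}"
    "{t. 0 \<le> weight t \<and> (\<forall>x\<in>X. 0 \<le> coupling (objective G x) t)} \<subseteq> D"
    "\<forall>t\<in>T. \<forall>x\<in>X. - \<epsilon> \<le> coupling (objective G x) t"
    by simp_all
qed

section \<open>The error bound\<close>

text \<open>
  The inequality \<open>0 \<le> coupling p t\<close> makes the sublevel sets of \<open>coupling y\<close> in \<open>D\<close> bounded, so from any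
  \<open>t\<close> one can descend to an extreme point of \<open>D\<close>.
\<close>

lemma coupling_lower_bound_from_vertices:
  assumes "closed D" "convex D" "D \<subseteq> {t. 0 \<le> weight t \<and> 0 \<le> coupling p t}"
    and vert: "\<And>v. v \<in> vertices D \<Longrightarrow> c \<le> coupling y v"
    and "t \<in> D"
  shows "c \<le> coupling y t"
proof -
  let ?a = "((\<chi> i. fst y $ i - snd y), -1)"
  have "{s \<in> D. ?a \<bullet> s \<le> ?a \<bullet> t} \<subseteq>
      {s. 0 \<le> weight s \<and> 0 \<le> coupling p s \<and> coupling y s \<le> coupling y t}"
    using assms(3) by (auto simp: coupling_affine[of y])
  then have "bounded {s \<in> D. ?a \<bullet> s \<le> ?a \<bullet> t}"
    using bounded_coupling_between bounded_subset by blast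
  then obtain v where "v extreme_point_of D" "?a \<bullet> v \<le> ?a \<bullet> t"
    using extreme_point_below assms by blast
  then show ?thesis using vert[of v] by (simp add: vertices_def coupling_affine)
qed

lemma linear_objective: "linear (objective G)"
  by (rule linearI)
    (simp_all add: objective_def matrix_vector_right_distrib sum.distrib
      matrix_vector_mult_scaleR sum_distrib_left)

theorem proposition11:
  fixes G :: "real^'n^'q"
    and g :: "'m::finite \<Rightarrow> real^'n \<Rightarrow> ereal"
    and \<epsilon> :: real
    and P_inner :: "((real^'q) \<times> real) set"
  assumes "rank G = CARD('q)"
    and "\<forall>i. ext_convex (g i)"
    and "convex_body (feasible_set g)"
    and "0 < \<epsilon>"
    and "dual_benson_result G (feasible_set g) \<epsilon> P_inner"
  shows "hausdorff_dist P_inner (upper_image G (feasible_set g))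
           \<le> ennreal (\<epsilon> * sqrt (real CARD('q) + 1))"
proof -
  let ?X = "feasible_set g"
  let ?P = "upper_image G ?X"
  let ?e = "(1, 1) :: (real^'q) \<times> real"
  from assms(5) obtain D T T' where st: "dual_benson_state G ?X \<epsilon> D T T'" and "T' - T = {}"
    and P: "P_inner = {y. \<forall>t\<in>D. 0 \<le> coupling y t}"
    by (auto simp: dual_benson_result_def)
  note inv = dual_benson_state_invariant[OF st]
  have vT: "vertices D \<subseteq> T" using inv(3) \<open>T' - T = {}\<close> by auto
  have X: "convex ?X" "compact ?X" "?X \<noteq> {}"
    using assms(3) interior_subset by (auto simp: convex_body_def)
  have sub: "P_inner \<subseteq> ?P"
  proof (rule subsetI, rule ccontr)
    fix y assume y: "y \<in> P_inner" "y \<notin> ?P"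
    have "continuous_on ?X (objective G)"
      using linear_objective by (rule linear_continuous_on[OF linear_linear[THEN iffD2]])
    then have "compact (objective G ` ?X)" using X(2) by (rule compact_continuous_image)
    moreover have "convex (objective G ` ?X)"
      using linear_objective X(1) by (rule convex_linear_image)
    moreover have "objective G ` ?X \<noteq> {}" using X(3) by simp
    ultimately obtain t where t: "0 \<le> weight t" "coupling y t < 0"
      "\<And>p. p \<in> objective G ` ?X \<Longrightarrow> 0 \<le> coupling p t"
      using y(2) unfolding upper_image_def by (rule supporting_weight) blast
    then have "t \<in> D" using inv(5) by blast
    then show False using t(2) y(1) P by force
  qed
  \<comment> \<open>The bound at the accepted vertices extends to all of \<open>D\<close>, and the shift compensates it.\<close>
  have near: "y + \<epsilon> *\<^sub>R ?e \<in> P_inner" if y: "y \<in> ?P" for y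
  proof -
    obtain x r where x: "x \<in> ?X" "0 \<le> r" "y = objective G x + r"
      using y by (auto simp: upper_image_def set_plus_def)
    obtain p where p: "D \<subseteq> {t. 0 \<le> weight t \<and> 0 \<le> coupling p t}" using inv(4) by blast
    have "- \<epsilon> \<le> coupling y v" if v: "v \<in> vertices D" for v
    proof -
      have "v \<in> D" using v by (simp add: vertices_def extreme_point_of_def)
      then have "coupling (objective G x) v \<le> coupling y v"
        using p x by (intro coupling_mono) auto
      then show ?thesis using inv(6) vT v x(1) by force
    qed
    then have low: "- \<epsilon> \<le> coupling y t" if "t \<in> D" for t
      using that by (rule coupling_lower_bound_from_vertices[OF inv(1,2) p])
    have "0 \<le> coupling (y + \<epsilon> *\<^sub>R ?e) t" if "t \<in> D" for t
      unfolding coupling_add_scaled_one using low[OF that] by linarith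
    then show ?thesis unfolding P by blast
  qed
  have dist: "dist (y + \<epsilon> *\<^sub>R ?e) y = \<epsilon> * sqrt (real CARD('q) + 1)" for y
    using assms(4) by (simp add: dist_norm norm_one_Pair_one del: scaleR_Pair)
  have "(INF a\<in>P_inner. ennreal (dist a y)) \<le> ennreal (\<epsilon> * sqrt (real CARD('q) + 1))"
    if "y \<in> ?P" for y
    using near[OF that] by (rule INF_lower2) (simp only: dist order_refl)
  then show ?thesis
    unfolding hausdorff_dist_subset[OF sub] by (rule SUP_least)
qed

end
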